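(* Let $(X,\tau)$ be an extended locally convex space. (1) If $\tau_{ucb}$ is normable, then the dimension of the quotient space $X/X_{fin}^\rho$ is finite for every continuous extended seminorm $\rho$ on $(X,\tau)$. (2) If $\tau_{ucb}$ is metrizable, then the dimension of the quotient space $X/X_{fin}^\rho$ is countable for every continuous extended seminorm $\rho$ on $(X,\tau)$.
   Context: Vector spaces are over $\mathbb{K}$, where $\mathbb{K}$ is $\mathbb{R}$ or $\mathbb{C}$. An extended seminorm on $X$ is a map $\rho:X\to[0,\infty]$ with $\rho(\alpha x)=|\alpha|\rho(x)$ (convention $0\cdot\infty=0$) and $\rho(x+y)\le\rho(x)+\rho(y)$. An extended locally convex space (elcs) is a vector space $X$ with a group topology $\tau$ induced by a family $\{\rho_i\}_{i\in I}$ of extended seminorms, i.e. the sets $\{y:\rho_i(y-x)<\varepsilon \text{ for all } i\in J\}$ with $\varepsilon>0$ and $J\subseteq I$ finite form a neighborhood base at $x$. For a continuous extended seminorm $\rho$, $X_{fin}^\rho=\{x\in X:\rho(x)<\infty\}$. $X^*$ is the set of all $\tau$-continuous linear functionals $X\to\mathbb{K}$. A set $A\subseteq X$ is bounded in $(X,\tau)$ if for every neighborhood $U$ of $0$ there exist $r>0$ and a finite set $F\subseteq A$ such that $A\subseteq F+rU$. $\tau_{ucb}$ is the locally convex topology on $X^*$ induced by the seminorms $f\mapsto\sup_{x\in B}|f(x)|$ with $B$ bounded in $(X,\tau)$. "Countable" includes finite. *)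

theory Defs
  imports "HOL-Analysis.Analysis" "HOL-Library.Function_Algebras"
begin

text \<open>
  Scalars range over an arbitrary type of class \<open>real_normed_field\<close>.  The norm of such a field is
  multiplicative, so by the Gelfand--Mazur theorem it is isometrically isomorphic to the reals or to
  the complex numbers; the class is exactly ``the field is real or complex''.  A vector space is a
  type of class \<open>ab_group_add\<close> with a scalar multiplication satisfying \<open>vector_space\<close>.
\<close>


section \<open>Topologies induced by extended seminorms\<close>

text \<open>In \<open>ennreal\<close> one has \<open>0 * \<infinity> = 0\<close>.\<close>

definition extended_seminorm ::
    "('k::real_normed_field \<Rightarrow> 'x::ab_group_add \<Rightarrow> 'x) \<Rightarrow> ('x \<Rightarrow> ennreal) \<Rightarrow> bool" where
  "extended_seminorm smul \<rho> \<longleftrightarrow>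
     (\<forall>a x. \<rho> (smul a x) = ennreal (norm a) * \<rho> x) \<and> (\<forall>x y. \<rho> (x + y) \<le> \<rho> x + \<rho> y)"

definition seminorm_nbhd ::
    "'v set \<Rightarrow> ('v::ab_group_add \<Rightarrow> ennreal) set \<Rightarrow> real \<Rightarrow> 'v \<Rightarrow> 'v set" where
  "seminorm_nbhd S J \<epsilon> x = {y \<in> S. \<forall>\<rho>\<in>J. \<rho> (y - x) < ennreal \<epsilon>}"

text \<open>
  The topology on the carrier \<open>S\<close> induced by the family \<open>P\<close>.  That the sets \<open>seminorm_nbhd S J \<epsilon> x\<close>
  really form a neighborhood base at \<open>x\<close> is lemma \<open>seminorm_nbhd_base\<close> below.
\<close>

definition seminorm_topology ::
    "'v set \<Rightarrow> ('v::ab_group_add \<Rightarrow> ennreal) set \<Rightarrow> 'v topology" where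
  "seminorm_topology S P = topology (\<lambda>U. U \<subseteq> S \<and>
     (\<forall>x\<in>U. \<exists>J \<epsilon>. finite J \<and> J \<subseteq> P \<and> 0 < \<epsilon> \<and> seminorm_nbhd S J \<epsilon> x \<subseteq> U))"

lemma seminorm_nbhd_Int:
  assumes "0 < \<epsilon>" "0 < \<delta>"
  shows "seminorm_nbhd S (J \<union> K) (min \<epsilon> \<delta>) x \<subseteq> seminorm_nbhd S J \<epsilon> x \<inter> seminorm_nbhd S K \<delta> x"
  using assms by (auto simp: seminorm_nbhd_def min_def ennreal_leI
      split: if_splits intro: less_le_trans)

lemma openin_seminorm_topology:
  "openin (seminorm_topology S P) U \<longleftrightarrow> U \<subseteq> S \<and>
     (\<forall>x\<in>U. \<exists>J \<epsilon>. finite J \<and> J \<subseteq> P \<and> 0 < \<epsilon> \<and> seminorm_nbhd S J \<epsilon> x \<subseteq> U)"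
proof -
  let ?L = "\<lambda>U. U \<subseteq> S \<and>
     (\<forall>x\<in>U. \<exists>J \<epsilon>. finite J \<and> J \<subseteq> P \<and> 0 < \<epsilon> \<and> seminorm_nbhd S J \<epsilon> x \<subseteq> U)"
  have "?L (A \<inter> B)" if A: "?L A" and B: "?L B" for A B
  proof (intro conjI ballI)
    show "A \<inter> B \<subseteq> S" using A by blast
    fix x assume x: "x \<in> A \<inter> B"
    obtain J \<epsilon> where J: "finite J" "J \<subseteq> P" "0 < \<epsilon>" "seminorm_nbhd S J \<epsilon> x \<subseteq> A"
      using A x by blast
    obtain K \<delta> where K: "finite K" "K \<subseteq> P" "0 < \<delta>" "seminorm_nbhd S K \<delta> x \<subseteq> B"
      using B x by blast
    have "seminorm_nbhd S (J \<union> K) (min \<epsilon> \<delta>) x \<subseteq> A \<inter> B"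
      using seminorm_nbhd_Int[OF J(3) K(3), of S J K x] J(4) K(4) by blast
    then show "\<exists>J \<epsilon>. finite J \<and> J \<subseteq> P \<and> 0 < \<epsilon> \<and> seminorm_nbhd S J \<epsilon> x \<subseteq> A \<inter> B"
      using J K by (intro exI[of _ "J \<union> K"] exI[of _ "min \<epsilon> \<delta>"]) auto
  qed
  moreover have "?L (\<Union>\<U>)" if "\<forall>A\<in>\<U>. ?L A" for \<U>
  proof (intro conjI ballI)
    show "\<Union>\<U> \<subseteq> S" using that by blast
    fix x assume "x \<in> \<Union>\<U>"
    then obtain A where A: "A \<in> \<U>" "x \<in> A" by blast
    then have "?L A" using that by blast
    then obtain J \<epsilon> where "finite J" "J \<subseteq> P" "0 < \<epsilon>" "seminorm_nbhd S J \<epsilon> x \<subseteq> A"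
      using A by blast
    then show "\<exists>J \<epsilon>. finite J \<and> J \<subseteq> P \<and> 0 < \<epsilon> \<and> seminorm_nbhd S J \<epsilon> x \<subseteq> \<Union>\<U>"
      using A by (meson Sup_upper order_trans)
  qed
  ultimately have "istopology ?L"
    unfolding istopology_def by blast
  then show ?thesis
    by (simp add: seminorm_topology_def topology_inverse')
qed

lemma topspace_seminorm_topology [simp]: "topspace (seminorm_topology S P) = S"
proof
  show "topspace (seminorm_topology S P) \<subseteq> S"
    unfolding topspace_def openin_seminorm_topology by blast
  have "\<exists>J \<epsilon>. finite J \<and> J \<subseteq> P \<and> (0::real) < \<epsilon> \<and> seminorm_nbhd S J \<epsilon> x \<subseteq> S" for x
    by (intro exI[of _ "{}"] exI[of _ 1]) (auto simp: seminorm_nbhd_def)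
  then have "openin (seminorm_topology S P) S"
    unfolding openin_seminorm_topology by blast
  then show "S \<subseteq> topspace (seminorm_topology S P)"
    by (rule openin_subset)
qed

lemma seminorm_nbhd_base:
  assumes zero: "\<And>\<rho>. \<rho> \<in> P \<Longrightarrow> \<rho> 0 = 0"
    and triangle: "\<And>\<rho> u v. \<rho> \<in> P \<Longrightarrow> \<rho> (u + v) \<le> \<rho> u + \<rho> v"
    and x: "x \<in> S"
  shows "(\<exists>U. openin (seminorm_topology S P) U \<and> x \<in> U \<and> U \<subseteq> N) \<longleftrightarrow>
         (\<exists>J \<epsilon>. finite J \<and> J \<subseteq> P \<and> 0 < \<epsilon> \<and> seminorm_nbhd S J \<epsilon> x \<subseteq> N)"
proof
  assume "\<exists>U. openin (seminorm_topology S P) U \<and> x \<in> U \<and> U \<subseteq> N"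
  then show "\<exists>J \<epsilon>. finite J \<and> J \<subseteq> P \<and> 0 < \<epsilon> \<and> seminorm_nbhd S J \<epsilon> x \<subseteq> N"
    unfolding openin_seminorm_topology by (meson order_trans)
next
  assume "\<exists>J \<epsilon>. finite J \<and> J \<subseteq> P \<and> 0 < \<epsilon> \<and> seminorm_nbhd S J \<epsilon> x \<subseteq> N"
  then obtain J \<epsilon> where J: "finite J" "J \<subseteq> P" "0 < \<epsilon>" "seminorm_nbhd S J \<epsilon> x \<subseteq> N"
    by blast
  have "openin (seminorm_topology S P) (seminorm_nbhd S J \<epsilon> x)"
    unfolding openin_seminorm_topology
  proof (intro conjI ballI)
    show "seminorm_nbhd S J \<epsilon> x \<subseteq> S" by (auto simp: seminorm_nbhd_def)
    fix y assume y: "y \<in> seminorm_nbhd S J \<epsilon> x"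
    have "\<exists>\<delta>>0. \<forall>\<rho>\<in>J. \<rho> (y - x) + ennreal \<delta> \<le> ennreal \<epsilon>"
      using J(1) y J(3)
    proof (induction J)
      case empty
      then show ?case by (auto intro: exI[of _ 1])
    next
      case (insert \<sigma> J)
      then obtain \<delta> where \<delta>: "\<delta> > 0" "\<forall>\<rho>\<in>J. \<rho> (y - x) + ennreal \<delta> \<le> ennreal \<epsilon>"
        by (auto simp: seminorm_nbhd_def)
      have lt: "\<sigma> (y - x) < ennreal \<epsilon>"
        using insert by (auto simp: seminorm_nbhd_def)
      then obtain r where r: "\<sigma> (y - x) = ennreal r" "0 \<le> r"
        by (cases "\<sigma> (y - x)") auto
      then have "r < \<epsilon>" using lt by (simp add: ennreal_less_iff)
      define \<eta> where "\<eta> = min \<delta> (\<epsilon> - r)"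
      have "\<eta> > 0" using \<open>r < \<epsilon>\<close> \<delta>(1) by (simp add: \<eta>_def)
      moreover have "\<sigma> (y - x) + ennreal \<eta> \<le> ennreal \<epsilon>"
        using r \<open>\<eta> > 0\<close> by (simp add: \<eta>_def flip: ennreal_plus)
      moreover have "\<rho> (y - x) + ennreal \<eta> \<le> ennreal \<epsilon>" if "\<rho> \<in> J" for \<rho>
      proof -
        have "\<rho> (y - x) + ennreal \<eta> \<le> \<rho> (y - x) + ennreal \<delta>"
          by (intro add_left_mono ennreal_leI) (simp add: \<eta>_def)
        then show ?thesis using \<delta>(2) that by (meson order_trans)
      qed
      ultimately show ?case by auto
    qed
    then obtain \<delta> where \<delta>: "\<delta> > 0" "\<forall>\<rho>\<in>J. \<rho> (y - x) + ennreal \<delta> \<le> ennreal \<epsilon>"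
      by blast
    have "seminorm_nbhd S J \<delta> y \<subseteq> seminorm_nbhd S J \<epsilon> x"
    proof
      fix z assume z: "z \<in> seminorm_nbhd S J \<delta> y"
      have "\<rho> (z - x) < ennreal \<epsilon>" if \<rho>: "\<rho> \<in> J" for \<rho>
      proof -
        have "\<rho> (y - x) < ennreal \<epsilon>" using y \<rho> by (auto simp: seminorm_nbhd_def)
        then have "\<rho> (y - x) \<noteq> top" by auto
        moreover have "\<rho> (z - y) < ennreal \<delta>" using z \<rho> by (auto simp: seminorm_nbhd_def)
        ultimately have "\<rho> (y - x) + \<rho> (z - y) < \<rho> (y - x) + ennreal \<delta>"
          by (simp add: ennreal_add_left_cancel_less)
        moreover have "\<rho> (z - x) \<le> \<rho> (y - x) + \<rho> (z - y)"
          using triangle[of \<rho> "y - x" "z - y"] \<rho> J(2) by auto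
        ultimately show ?thesis using \<delta>(2) \<rho> by (meson le_less_trans less_le_trans)
      qed
      then show "z \<in> seminorm_nbhd S J \<epsilon> x" using z by (auto simp: seminorm_nbhd_def)
    qed
    then show "\<exists>K \<delta>. finite K \<and> K \<subseteq> P \<and> 0 < \<delta> \<and> seminorm_nbhd S K \<delta> y \<subseteq> seminorm_nbhd S J \<epsilon> x"
      using J \<delta> by blast
  qed
  moreover have "\<rho> 0 < ennreal \<epsilon>" if "\<rho> \<in> J" for \<rho>
    using zero[of \<rho>] J(2,3) that by auto
  then have "x \<in> seminorm_nbhd S J \<epsilon> x"
    using x by (auto simp: seminorm_nbhd_def)
  ultimately show "\<exists>U. openin (seminorm_topology S P) U \<and> x \<in> U \<and> U \<subseteq> N"
    using J(4) by blast
qed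

text \<open>
  A topology of this form is automatically a group topology, and neither the family of extended
  seminorms nor the topology is required to separate points.
\<close>

definition elcs ::
    "('k::real_normed_field \<Rightarrow> 'x::ab_group_add \<Rightarrow> 'x) \<Rightarrow> 'x topology \<Rightarrow> bool" where
  "elcs smul \<tau> \<longleftrightarrow> vector_space smul \<and>
     (\<exists>P. (\<forall>\<rho>\<in>P. extended_seminorm smul \<rho>) \<and> \<tau> = seminorm_topology UNIV P)"

text \<open>Continuity refers to the usual topology of \<open>[0,\<infinity>]\<close>.\<close>

definition continuous_extended_seminorm ::
    "('k::real_normed_field \<Rightarrow> 'x::ab_group_add \<Rightarrow> 'x) \<Rightarrow> 'x topology \<Rightarrow> ('x \<Rightarrow> ennreal) \<Rightarrow> bool" where
  "continuous_extended_seminorm smul \<tau> \<rho> \<longleftrightarrow>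
     extended_seminorm smul \<rho> \<and> continuous_map \<tau> euclidean \<rho>"

definition fin_subspace :: "('x \<Rightarrow> ennreal) \<Rightarrow> 'x set" where
  "fin_subspace \<rho> = {x. \<rho> x < \<infinity>}"


section \<open>The dual space and the topology of uniform convergence on bounded sets\<close>

definition dual_space ::
    "('k::real_normed_field \<Rightarrow> 'x::ab_group_add \<Rightarrow> 'x) \<Rightarrow> 'x topology \<Rightarrow> ('x \<Rightarrow> 'k) set" where
  "dual_space smul \<tau> = {f. Vector_Spaces.linear smul (*) f \<and> continuous_map \<tau> euclidean f}"

text \<open>Here \<open>+\<close> is the elementwise sum of sets.\<close>

definition elcs_bounded ::
    "('k::real_normed_field \<Rightarrow> 'x::ab_group_add \<Rightarrow> 'x) \<Rightarrow> 'x topology \<Rightarrow> 'x set \<Rightarrow> bool" where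
  "elcs_bounded smul \<tau> A \<longleftrightarrow>
     (\<forall>U. (\<exists>V. openin \<tau> V \<and> 0 \<in> V \<and> V \<subseteq> U) \<longrightarrow>
        (\<exists>r F. (r::real) > 0 \<and> finite F \<and> F \<subseteq> A \<and> A \<subseteq> F + smul (of_real r) ` U))"

text \<open>
  The supremum is taken in \<open>ennreal\<close>, so that it is \<open>0\<close> for the empty bounded set; it is finite for
  \<open>f\<close> in the dual space and bounded \<open>B\<close>.  Differences of functionals are pointwise.
\<close>

definition ucb_topology ::
    "('k::real_normed_field \<Rightarrow> 'x::ab_group_add \<Rightarrow> 'x) \<Rightarrow> 'x topology \<Rightarrow> ('x \<Rightarrow> 'k) topology" where
  "ucb_topology smul \<tau> = seminorm_topology (dual_space smul \<tau>)
     {\<lambda>f. SUP x\<in>B. ennreal (norm (f x)) | B. elcs_bounded smul \<tau> B}"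

text \<open>A norm on a subspace \<open>S\<close> of a space with scalar multiplication \<open>sc\<close>.\<close>

definition is_norm_on ::
    "('k::real_normed_field \<Rightarrow> 'v::ab_group_add \<Rightarrow> 'v) \<Rightarrow> 'v set \<Rightarrow> ('v \<Rightarrow> real) \<Rightarrow> bool" where
  "is_norm_on sc S N \<longleftrightarrow>
     (\<forall>f\<in>S. 0 \<le> N f \<and> (N f = 0 \<longleftrightarrow> f = 0)) \<and>
     (\<forall>a. \<forall>f\<in>S. N (sc a f) = norm a * N f) \<and>
     (\<forall>f\<in>S. \<forall>g\<in>S. N (f + g) \<le> N f + N g)"

definition normable ::
    "('k::real_normed_field \<Rightarrow> 'v::ab_group_add \<Rightarrow> 'v) \<Rightarrow> 'v topology \<Rightarrow> bool" where
  "normable sc T \<longleftrightarrow>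
     (\<exists>N. is_norm_on sc (topspace T) N \<and> T = seminorm_topology (topspace T) {\<lambda>f. ennreal (N f)})"

text \<open>The pointwise scalar multiplication of functionals.\<close>

definition fun_scale :: "'k::real_normed_field \<Rightarrow> ('x \<Rightarrow> 'k) \<Rightarrow> ('x \<Rightarrow> 'k)" where
  "fun_scale a f = (\<lambda>x. a * f x)"


section \<open>The dimension of a quotient space\<close>

text \<open>
  The vectors of the quotient by a subspace \<open>W\<close> are the cosets of \<open>W\<close>.  The zero vector is \<open>W\<close>, and
  the sum of two cosets is their elementwise sum.  A scalar multiple \<open>smul a ` A\<close> of a coset is
  again a coset, except that it is \<open>{0}\<close> instead of \<open>W\<close> for \<open>a = 0\<close>.  Adding \<open>W\<close> to the whole
  linear combination repairs this and also makes the empty sum equal to \<open>W\<close>; see \<open>quotient_lincomb_cosets\<close>.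
\<close>

definition quotient_space :: "'x::ab_group_add set \<Rightarrow> 'x set set" where
  "quotient_space W = range (\<lambda>x. x +o W)"

definition quotient_lincomb ::
    "('k::real_normed_field \<Rightarrow> 'x::ab_group_add \<Rightarrow> 'x) \<Rightarrow> 'x set \<Rightarrow> 'x set set \<Rightarrow> ('x set \<Rightarrow> 'k) \<Rightarrow> 'x set" where
  "quotient_lincomb smul W T c = W + (\<Sum>A\<in>T. smul (c A) ` A)"

lemma quotient_lincomb_cosets:
  assumes "vector_space smul" and W: "module.subspace smul W"
    and "finite T" and "\<And>A. A \<in> T \<Longrightarrow> A = rep A +o W"
  shows "quotient_lincomb smul W T c = (\<Sum>A\<in>T. smul (c A) (rep A)) +o W"
proof -
  interpret vector_space smul by fact
  have WW: "W + W = W"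
  proof
    show "W + W \<subseteq> W" using W by (auto simp: set_plus_def subspace_add)
    show "W \<subseteq> W + W" using subspace_0[OF W] by (force simp: set_plus_def)
  qed
  have sc: "W + smul a ` (x +o W) = smul a x +o W" for a x
  proof
    show "W + smul a ` (x +o W) \<subseteq> smul a x +o W"
    proof
      fix z assume "z \<in> W + smul a ` (x +o W)"
      then obtain w v where "w \<in> W" "v \<in> W" and z: "z = w + smul a (x + v)"
        by (auto simp: set_plus_def elt_set_plus_def)
      then have "w + smul a v \<in> W" using W by (simp add: subspace_add subspace_scale)
      moreover have "z = smul a x + (w + smul a v)" by (simp add: z scale_right_distrib)
      ultimately show "z \<in> smul a x +o W" by (auto simp: elt_set_plus_def)
    qed
    show "smul a x +o W \<subseteq> W + smul a ` (x +o W)"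
    proof
      fix z assume "z \<in> smul a x +o W"
      then obtain w where w: "w \<in> W" "z = w + smul a x"
        by (auto simp: elt_set_plus_def add.commute)
      moreover have "x \<in> x +o W" using subspace_0[OF W] by (force simp: elt_set_plus_def)
      ultimately show "z \<in> W + smul a ` (x +o W)" by blast
    qed
  qed
  show ?thesis
    using assms(3,4) unfolding quotient_lincomb_def
  proof (induction T)
    case empty
    then show ?case by (simp add: elt_set_plus_def)
  next
    case (insert A T)
    have "W + (\<Sum>A\<in>insert A T. smul (c A) ` A) = W + W + (smul (c A) ` A + (\<Sum>A\<in>T. smul (c A) ` A))"
      using insert(1,2) by (simp add: WW)
    also have "\<dots> = (W + smul (c A) ` A) + (W + (\<Sum>A\<in>T. smul (c A) ` A))"
      by (simp only: add.assoc add.left_commute)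
    also have "W + smul (c A) ` A = smul (c A) (rep A) +o W"
      using sc insert.prems by (metis insertI1)
    also have "W + (\<Sum>A\<in>T. smul (c A) ` A) = (\<Sum>A\<in>T. smul (c A) (rep A)) +o W"
      using insert by simp
    finally show ?case
      using insert(1,2) by (simp add: set_plus_rearrange WW)
  qed
qed

definition quotient_independent ::
    "('k::real_normed_field \<Rightarrow> 'x::ab_group_add \<Rightarrow> 'x) \<Rightarrow> 'x set \<Rightarrow> 'x set set \<Rightarrow> bool" where
  "quotient_independent smul W \<B> \<longleftrightarrow>
     (\<forall>T c. finite T \<and> T \<subseteq> \<B> \<and> quotient_lincomb smul W T c = W \<longrightarrow> (\<forall>A\<in>T. c A = 0))"

definition quotient_span ::
    "('k::real_normed_field \<Rightarrow> 'x::ab_group_add \<Rightarrow> 'x) \<Rightarrow> 'x set \<Rightarrow> 'x set set \<Rightarrow> 'x set set" where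
  "quotient_span smul W \<B> = {quotient_lincomb smul W T c | T c. finite T \<and> T \<subseteq> \<B>}"

definition quotient_basis ::
    "('k::real_normed_field \<Rightarrow> 'x::ab_group_add \<Rightarrow> 'x) \<Rightarrow> 'x set \<Rightarrow> 'x set set \<Rightarrow> bool" where
  "quotient_basis smul W \<B> \<longleftrightarrow> \<B> \<subseteq> quotient_space W \<and>
     quotient_independent smul W \<B> \<and> quotient_span smul W \<B> = quotient_space W"

definition finite_dim_quotient ::
    "('k::real_normed_field \<Rightarrow> 'x::ab_group_add \<Rightarrow> 'x) \<Rightarrow> 'x set \<Rightarrow> bool" where
  "finite_dim_quotient smul W \<longleftrightarrow> (\<exists>\<B>. quotient_basis smul W \<B> \<and> finite \<B>)"

definition countable_dim_quotient ::
    "('k::real_normed_field \<Rightarrow> 'x::ab_group_add \<Rightarrow> 'x) \<Rightarrow> 'x set \<Rightarrow> bool" where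
  "countable_dim_quotient smul W \<longleftrightarrow> (\<exists>\<B>. quotient_basis smul W \<B> \<and> countable \<B>)"

end

theory Submission
  imports Defs
begin

text \<open>
  Let \<open>W\<close> be the finite part of a continuous extended seminorm \<open>\<rho>\<close>.  Two facts connect
  the quotient by \<open>W\<close> with the dual.

  Since the unit ball of \<open>\<rho>\<close> is a neighborhood of \<open>0\<close> inside \<open>W\<close>, every linear functional
  that vanishes on \<open>W\<close> is constant near each point, hence continuous
  (\<open>functional_vanishing_on_fin_subspace_continuous\<close>).  So the whole algebraic dual of the
  quotient sits inside the topological dual.  On the other hand, testing boundedness against the
  unit ball shows that a bounded set meets only finitely many cosets of \<open>W\<close>
  (\<open>bounded_finite_modulo_fin_subspace\<close>).

  A neighborhood of \<open>0\<close> in the dual restricts functionals on finitely many bounded sets only; for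
  functionals vanishing on \<open>W\<close> this amounts to finitely many points, and those that vanish at
  these points all belong to the neighborhood (\<open>nbhd_in_dual_controls_finitely_many\<close>).  Take a family of
  neighborhoods whose intersection contains no line, and let \<open>E\<close> collect the finitely many points
  belonging to each of them.  If \<open>E \<union> W\<close> did not span the space, a nonzero functional would
  vanish on it, and the line through this functional would lie in every neighborhood of the family.
  Hence the cosets of the points of \<open>E\<close> generate the quotient
  (\<open>quotient_basis_from_dual_nbhds\<close>).

  For a normable dual the unit ball alone is such a family, so \<open>E\<close> is finite; for a metrizable
  dual the balls of radius \<open>1/n\<close> around \<open>0\<close> intersect in \<open>{0}\<close>, so \<open>E\<close> is countable.
\<close>


section \<open>Bases of a quotient space\<close>

text \<open>
  The elements of \<open>C - B\<close> are independent modulo the span of \<open>B\<close>: if the coefficient at \<open>d\<close> were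
  nonzero, the relation could be solved for \<open>d\<close>, putting it into the span of the rest of \<open>C\<close>.
\<close>

lemma (in vector_space) sum_in_span_sub_basis:
  assumes C: "independent C" and "B \<subseteq> C" and S: "finite S" "S \<subseteq> C - B"
    and sum: "(\<Sum>d\<in>S. scale (a d) d) \<in> span B" and d: "d \<in> S"
  shows "a d = 0"
proof (rule ccontr)
  assume "a d \<noteq> 0"
  have "span B \<subseteq> span (C - {d})"
    using assms by (intro span_mono) auto
  moreover have "(\<Sum>e\<in>S - {d}. scale (a e) e) \<in> span (C - {d})"
    using S by (intro span_sum span_scale span_base) auto
  ultimately have "(\<Sum>e\<in>S. scale (a e) e) - (\<Sum>e\<in>S - {d}. scale (a e) e) \<in> span (C - {d})"
    using sum by (intro span_diff) auto
  then have "scale (a d) d \<in> span (C - {d})"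
    using S(1) d by (simp add: sum.remove)
  then have "d \<in> span (C - {d})"
    using \<open>a d \<noteq> 0\<close> span_scale[of "scale (a d) d" "C - {d}" "inverse (a d)"] by simp
  then show False
    using C d S(2) dependent_def by blast
qed

text \<open>
  Extend a basis \<open>B\<close> of \<open>W\<close> by elements of \<open>E\<close> to a basis \<open>C\<close> of the whole space.  The
  cosets of the elements of \<open>C - B\<close> then form a basis of the quotient.
\<close>

lemma quotient_basis_from_generators:
  fixes smul :: "'k::real_normed_field \<Rightarrow> 'x::ab_group_add \<Rightarrow> 'x"
  assumes "vector_space smul" and W: "module.subspace smul W"
    and gen: "module.span smul (E \<union> W) = UNIV"
  shows "\<exists>D\<subseteq>E. quotient_basis smul W ((\<lambda>d. d +o W) ` D)"
proof -
  interpret vector_space smul by fact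
  obtain B where B: "B \<subseteq> W" "independent B" "W \<subseteq> span B"
    using maximal_independent_subset[of W] by blast
  have spanB: "span B = W"
    using B W by (simp add: span_minimal subset_antisym)
  obtain C where C: "B \<subseteq> C" "C \<subseteq> E \<union> B" "independent C" "E \<union> B \<subseteq> span C"
    using maximal_independent_subset_extend[of B "E \<union> B"] B(2) by blast
  have "W \<subseteq> span C"
    using span_mono[OF C(1)] spanB by simp
  then have "span (E \<union> W) \<subseteq> span C"
    using C(4) by (intro span_minimal) auto
  then have spanC: "span C = UNIV"
    using gen by auto
  let ?D = "C - B"
  let ?\<B> = "(\<lambda>d. d +o W) ` ?D"
  define rep where "rep = inv_into ?D (\<lambda>d. d +o W)"
  have rep: "rep A \<in> ?D" "A = rep A +o W" if "A \<in> ?\<B>" for A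
    using inv_into_into[OF that] f_inv_into_f[OF that] by (auto simp: rep_def)
  have rep_inj: "inj_on rep ?\<B>"
    by (metis (no_types, lifting) inj_onI rep(2))
  have coset_eq: "x +o W = y +o W \<longleftrightarrow> x - y \<in> W" for x y
  proof
    assume "x +o W = y +o W"
    moreover have "x \<in> x +o W"
      using subspace_0[OF W] by (force simp: elt_set_plus_def)
    ultimately show "x - y \<in> W"
      by (auto simp: elt_set_plus_def)
  next
    have sub: "u +o W \<subseteq> v +o W" if "u - v \<in> W" for u v
    proof
      fix z assume "z \<in> u +o W"
      then obtain w where "w \<in> W" "z = u + w"
        by (auto simp: elt_set_plus_def)
      then have "z = v + ((u - v) + w)" "(u - v) + w \<in> W"
        using that W by (auto simp: subspace_add)
      then show "z \<in> v +o W"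
        unfolding elt_set_plus_def by blast
    qed
    assume "x - y \<in> W"
    moreover from this have "y - x \<in> W"
      using W by (metis minus_diff_eq subspace_neg)
    ultimately show "x +o W = y +o W"
      using sub by blast
  qed
  have W0: "0 +o W = W"
    by (simp add: elt_set_plus_def)
  have lincomb: "quotient_lincomb smul W T c = (\<Sum>A\<in>T. smul (c A) (rep A)) +o W"
    if "finite T" "T \<subseteq> ?\<B>" for T c
    using that rep(2) by (intro quotient_lincomb_cosets assms(1) W) blast+
  have "quotient_independent smul W ?\<B>"
    unfolding quotient_independent_def
  proof (intro allI impI ballI)
    fix T c A
    assume T: "finite T \<and> T \<subseteq> ?\<B> \<and> quotient_lincomb smul W T c = W" and A: "A \<in> T"
    define a where "a = (\<lambda>d. c (d +o W))"
    have "(\<Sum>A\<in>T. smul (c A) (rep A)) \<in> W"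
    proof -
      have "(\<Sum>A\<in>T. smul (c A) (rep A)) +o W = 0 +o W"
        using T lincomb[of T c] W0 by metis
      then show ?thesis
        by (simp only: coset_eq diff_zero)
    qed
    also have "(\<Sum>A\<in>T. smul (c A) (rep A)) = (\<Sum>A\<in>T. smul (a (rep A)) (rep A))"
      using T rep(2) by (intro sum.cong) (auto simp: a_def)
    also have "\<dots> = (\<Sum>d\<in>rep ` T. smul (a d) d)"
      using T inj_on_subset[OF rep_inj] by (subst sum.reindex) (auto simp: o_def)
    finally have "(\<Sum>d\<in>rep ` T. smul (a d) d) \<in> span B"
      by (simp add: spanB)
    moreover have "rep ` T \<subseteq> C - B"
      using T rep(1) by blast
    ultimately have "a (rep A) = 0"
      using sum_in_span_sub_basis[OF C(3,1), of "rep ` T" a "rep A"] T A by blast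
    then show "c A = 0"
      using rep(2)[of A] T A by (auto simp: a_def)
  qed
  moreover have "quotient_span smul W ?\<B> = quotient_space W"
  proof
    show "quotient_span smul W ?\<B> \<subseteq> quotient_space W"
      by (auto simp: quotient_span_def quotient_space_def lincomb)
    show "quotient_space W \<subseteq> quotient_span smul W ?\<B>"
    proof
      fix Y assume "Y \<in> quotient_space W"
      then obtain y where y: "Y = y +o W"
        by (auto simp: quotient_space_def)
      have "y \<in> span (?D \<union> B)"
        using spanC C(1) by (simp add: Un_absorb2)
      then obtain u w where "u \<in> span ?D" "w \<in> span B" and yuw: "y = u + w"
        unfolding span_Un by blast
      obtain S a where S: "finite S" "S \<subseteq> ?D" and u: "u = (\<Sum>d\<in>S. smul (a d) d)"
        using \<open>u \<in> span ?D\<close> by (auto simp: span_explicit)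
      \<comment> \<open>Different elements of \<open>C - B\<close> lie in different cosets: otherwise \<open>d - e\<close> would be a
        dependence modulo the span of \<open>B\<close>.\<close>
      have repc: "rep (d +o W) = d" if "d \<in> ?D" for d
      proof (rule ccontr)
        assume ne: "rep (d +o W) \<noteq> d"
        define e where "e = rep (d +o W)"
        have e: "e \<in> ?D" "d +o W = e +o W"
          using rep that by (auto simp: e_def)
        then have "d - e \<in> span B"
          by (simp add: coset_eq spanB)
        then have "(\<Sum>i\<in>{d, e}. smul (if i = d then 1 else - 1) i) \<in> span B"
          using ne by (simp add: e_def)
        from sum_in_span_sub_basis[OF C(3,1) _ _ this, of d] e that
        show False by auto
      qed
      have inj: "inj_on (\<lambda>d. d +o W) S"
        using repc S(2) by (intro inj_on_inverseI[of _ rep]) auto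
      let ?T = "(\<lambda>d. d +o W) ` S"
      have "quotient_lincomb smul W ?T (\<lambda>A. a (rep A)) =
          (\<Sum>A\<in>?T. smul (a (rep A)) (rep A)) +o W"
        using S by (intro lincomb) auto
      also have "(\<Sum>A\<in>?T. smul (a (rep A)) (rep A)) = u"
        unfolding u sum.reindex[OF inj] o_def
        using repc S(2) by (intro sum.cong) (auto simp: subset_iff)
      also have "u +o W = Y"
        using W \<open>w \<in> span B\<close> by (simp add: y coset_eq yuw spanB subspace_neg)
      finally show "Y \<in> quotient_span smul W ?\<B>"
        unfolding quotient_span_def using S
        by (intro CollectI exI[of _ ?T] exI[of _ "\<lambda>A. a (rep A)"]) auto
    qed
  qed
  moreover have "?\<B> \<subseteq> quotient_space W"
    by (auto simp: quotient_space_def)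
  ultimately have "quotient_basis smul W ?\<B>"
    by (simp add: quotient_basis_def)
  moreover have "?D \<subseteq> E"
    using C(2) by blast
  ultimately show ?thesis
    by blast
qed


section \<open>Functionals and bounded sets modulo the finite part of a seminorm\<close>

lemma (in vector_space) exists_functional_separating_span:
  fixes a :: 'b
  assumes "a \<notin> span S"
  shows "\<exists>f. Vector_Spaces.linear scale (*) f \<and> (\<forall>s\<in>S. f s = 0) \<and> f a = 1"
proof -
  interpret K: vector_space "(*) :: 'a \<Rightarrow> 'a \<Rightarrow> 'a"
    by unfold_locales (auto simp: algebra_simps)
  interpret vector_space_pair scale "(*) :: 'a \<Rightarrow> 'a \<Rightarrow> 'a" ..
  obtain B where B: "B \<subseteq> S" "independent B" "S \<subseteq> span B"
    using maximal_independent_subset[of S] by blast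
  have a: "a \<notin> span B"
    using assms span_mono[OF B(1)] by blast
  then have "independent (insert a B)"
    using B(2) by (simp add: independent_insertI)
  then obtain f where f: "Vector_Spaces.linear scale (*) f"
    "\<forall>x\<in>insert a B. f x = (if x = a then 1 else 0)"
    using linear_independent_extend[of "insert a B" "\<lambda>x. if x = a then 1 else 0"] by blast
  have "f x = 0" if "x \<in> B" for x
    using f(2) that a span_base[of x B] by auto
  then have "f s = 0" if "s \<in> S" for s
    using linear_eq_0_on_span[OF f(1)] B(3) that by blast
  then show ?thesis
    using f by auto
qed

lemma extended_seminorm_zero:
  assumes "vector_space smul" "extended_seminorm smul \<rho>"
  shows "\<rho> 0 = 0"
proof -
  interpret vector_space smul by fact
  have "\<rho> (smul 0 0) = ennreal (norm (0::'a)) * \<rho> 0"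
    using assms(2) unfolding extended_seminorm_def by blast
  then show ?thesis by simp
qed

lemma subspace_fin_subspace:
  assumes "vector_space smul" "extended_seminorm smul \<rho>"
  shows "module.subspace smul (fin_subspace \<rho>)"
proof -
  interpret vector_space smul by fact
  have add: "\<rho> (x + y) \<le> \<rho> x + \<rho> y" and scale: "\<rho> (smul a x) = ennreal (norm a) * \<rho> x" for a x y
    using assms(2) by (auto simp: extended_seminorm_def)
  show ?thesis
    using extended_seminorm_zero[OF assms]
    by (auto simp: subspace_def fin_subspace_def scale ennreal_mult_less_top
        intro!: le_less_trans[OF add])
qed

lemma openin_unit_ball:
  assumes "continuous_map \<tau> euclidean \<rho>" "topspace \<tau> = UNIV"
  shows "openin \<tau> {x. \<rho> x < (1::ennreal)}"
proof -
  have "openin \<tau> {x \<in> topspace \<tau>. \<rho> x \<in> {..<1}}"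
    using assms(1) by (rule openin_continuous_map_preimage) (simp add: open_lessThan)
  then show ?thesis
    by (simp add: assms(2))
qed

text \<open>
  Such a functional is constant on the translates of the unit ball of \<open>\<rho>\<close>, so even all its
  preimages of arbitrary sets are open.
\<close>

lemma functional_vanishing_on_fin_subspace_continuous:
  fixes smul :: "'k::real_normed_field \<Rightarrow> 'x::ab_group_add \<Rightarrow> 'x"
  assumes "elcs smul \<tau>" and \<rho>: "continuous_extended_seminorm smul \<tau> \<rho>"
    and f: "Vector_Spaces.linear smul (*) f" and f0: "\<And>x. x \<in> fin_subspace \<rho> \<Longrightarrow> f x = 0"
  shows "f \<in> dual_space smul \<tau>"
proof -
  obtain P where vs: "vector_space smul" and P: "\<tau> = seminorm_topology UNIV P"
    using assms(1) by (auto simp: elcs_def)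
  interpret f: Vector_Spaces.linear smul "(*)" f by fact
  have "openin \<tau> {x. \<rho> x < 1}" "\<rho> 0 = 0"
    using \<rho> vs by (auto simp: continuous_extended_seminorm_def P
        intro: openin_unit_ball extended_seminorm_zero)
  moreover from this have "0 \<in> {x. \<rho> x < 1}"
    by simp
  ultimately obtain J \<epsilon> where J: "finite J" "J \<subseteq> P" "0 < \<epsilon>" "seminorm_nbhd UNIV J \<epsilon> 0 \<subseteq> {x. \<rho> x < 1}"
    unfolding P openin_seminorm_topology by meson
  have "f y = f x" if "y \<in> seminorm_nbhd UNIV J \<epsilon> x" for x y
  proof -
    have "y - x \<in> seminorm_nbhd UNIV J \<epsilon> 0"
      using that by (simp add: seminorm_nbhd_def)
    then have "\<rho> (y - x) < 1"
      using J(4) by blast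
    also have "1 < (\<infinity>::ennreal)" by simp
    finally have "f (y - x) = 0"
      by (intro f0) (simp add: fin_subspace_def)
    then show ?thesis
      by (simp add: f.diff)
  qed
  then have "seminorm_nbhd UNIV J \<epsilon> x \<subseteq> {y. f y \<in> V}" if "f x \<in> V" for x V
    using that by auto
  then have "openin \<tau> {x. f x \<in> V}" for V
    unfolding P openin_seminorm_topology using J(1-3) by (intro conjI ballI exI[of _ J] exI[of _ \<epsilon>]) auto
  then show ?thesis
    using f by (simp add: dual_space_def continuous_map_def P)
qed

text \<open>
  A bounded set is covered by finitely many translates of a multiple of the unit ball of \<open>\<rho>\<close>, and
  every multiple of this ball stays inside the finite part of \<open>\<rho>\<close>.
\<close>

lemma bounded_finite_modulo_fin_subspace:
  fixes smul :: "'k::real_normed_field \<Rightarrow> 'x::ab_group_add \<Rightarrow> 'x"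
  assumes "elcs smul \<tau>" and \<rho>: "continuous_extended_seminorm smul \<tau> \<rho>"
    and "elcs_bounded smul \<tau> B"
  shows "\<exists>F. finite F \<and> B \<subseteq> F + fin_subspace \<rho>"
proof -
  have vs: "vector_space smul" and top: "topspace \<tau> = UNIV"
    using assms(1) by (auto simp: elcs_def)
  interpret vector_space smul by fact
  let ?U = "{x. \<rho> x < 1}"
  have sn: "extended_seminorm smul \<rho>"
    using \<rho> by (simp add: continuous_extended_seminorm_def)
  have "openin \<tau> ?U" "0 \<in> ?U"
    using \<rho> top openin_unit_ball extended_seminorm_zero[OF vs sn]
    by (auto simp: continuous_extended_seminorm_def)
  then obtain r F where "finite F" and F: "B \<subseteq> F + smul (of_real r) ` ?U"
    using assms(3) unfolding elcs_bounded_def by blast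
  have "?U \<subseteq> fin_subspace \<rho>"
    by (auto simp: fin_subspace_def intro: less_trans[of _ 1])
  then have "smul (of_real r) ` ?U \<subseteq> fin_subspace \<rho>"
    using subspace_fin_subspace[OF vs sn] by (auto intro: subspace_scale)
  then have "F + smul (of_real r) ` ?U \<subseteq> F + fin_subspace \<rho>"
    by (auto simp: set_plus_def)
  then show ?thesis
    using F \<open>finite F\<close> by (meson order_trans)
qed


section \<open>Generating the quotient from neighborhoods in the dual\<close>

text \<open>
  A basic neighborhood involves finitely many suprema over bounded sets.  Each of these sets is
  contained in \<open>F + W\<close> with \<open>F\<close> finite, so a functional that is zero on \<open>F\<close> and on \<open>W\<close> makes
  the supremum zero, whatever the radius of the neighborhood.
\<close>

lemma nbhd_in_dual_controls_finitely_many: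
  fixes smul :: "'k::real_normed_field \<Rightarrow> 'x::ab_group_add \<Rightarrow> 'x"
  assumes el: "elcs smul \<tau>" and \<rho>: "continuous_extended_seminorm smul \<tau> \<rho>"
    and U: "openin (ucb_topology smul \<tau>) U" "0 \<in> U"
  shows "\<exists>F. finite F \<and> (\<forall>f\<in>dual_space smul \<tau>. (\<forall>x\<in>F \<union> fin_subspace \<rho>. f x = 0) \<longrightarrow> f \<in> U)"
proof -
  obtain J \<epsilon> where J: "finite J" "0 < \<epsilon>"
    "J \<subseteq> {\<lambda>f. SUP x\<in>B. ennreal (norm (f x)) | B. elcs_bounded smul \<tau> B}"
    "seminorm_nbhd (dual_space smul \<tau>) J \<epsilon> 0 \<subseteq> U"
    using U unfolding ucb_topology_def openin_seminorm_topology by blast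
  have "\<exists>F. finite F \<and> (\<forall>f\<in>dual_space smul \<tau>. (\<forall>x\<in>F \<union> fin_subspace \<rho>. f x = 0) \<longrightarrow> p f = 0)"
    if p: "p \<in> J" for p
  proof -
    obtain B where B: "elcs_bounded smul \<tau> B" "p = (\<lambda>f. SUP x\<in>B. ennreal (norm (f x)))"
      using J(3) p by blast
    obtain F where F: "finite F" "B \<subseteq> F + fin_subspace \<rho>"
      using bounded_finite_modulo_fin_subspace[OF el \<rho> B(1)] by blast
    have "p f = 0" if f: "f \<in> dual_space smul \<tau>" "\<forall>x\<in>F \<union> fin_subspace \<rho>. f x = 0" for f
    proof -
      interpret f: Vector_Spaces.linear smul "(*)" f
        using f(1) by (simp add: dual_space_def)
      have "f x = 0" if "x \<in> B" for x
        using F(2) f(2) that by (fastforce simp: set_plus_def f.add)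
      then show ?thesis
        unfolding B(2) by (intro antisym SUP_least) auto
    qed
    then show ?thesis
      using F(1) by blast
  qed
  then obtain F where F: "\<And>p. p \<in> J \<Longrightarrow> finite (F p)"
    "\<And>p f. p \<in> J \<Longrightarrow> f \<in> dual_space smul \<tau> \<Longrightarrow> \<forall>x\<in>F p \<union> fin_subspace \<rho>. f x = 0 \<Longrightarrow> p f = 0"
    by metis
  have "f \<in> U" if "f \<in> dual_space smul \<tau>" "\<forall>x\<in>(\<Union>p\<in>J. F p) \<union> fin_subspace \<rho>. f x = 0" for f
  proof -
    have "p f < ennreal \<epsilon>" if "p \<in> J" for p
      using J(2) F(2)[OF that] that \<open>f \<in> dual_space smul \<tau>\<close>
        \<open>\<forall>x\<in>(\<Union>p\<in>J. F p) \<union> fin_subspace \<rho>. f x = 0\<close> by force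
    then have "f \<in> seminorm_nbhd (dual_space smul \<tau>) J \<epsilon> 0"
      using that(1) by (simp add: seminorm_nbhd_def)
    then show ?thesis
      using J(4) by blast
  qed
  moreover have "finite (\<Union>p\<in>J. F p)"
    using J(1) F(1) by blast
  ultimately show ?thesis
    by blast
qed

text \<open>
  Asking for no line, instead of the trivial intersection, admits the unit ball of a norm as a
  family with one member.  The family \<open>F\<close> of finite sets lets the dimension inherit the size of
  \<open>\<U>\<close>: the basis is finite if \<open>\<U>\<close> is, and countable if \<open>\<U>\<close> is.
\<close>

lemma quotient_basis_from_dual_nbhds:
  fixes smul :: "'k::real_normed_field \<Rightarrow> 'x::ab_group_add \<Rightarrow> 'x"
  assumes el: "elcs smul \<tau>" and \<rho>: "continuous_extended_seminorm smul \<tau> \<rho>"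
    and \<U>: "\<And>U. U \<in> \<U> \<Longrightarrow> openin (ucb_topology smul \<tau>) U \<and> 0 \<in> U"
    and no_line: "\<And>f. f \<in> dual_space smul \<tau> \<Longrightarrow> (\<And>a. fun_scale a f \<in> \<Inter>\<U>) \<Longrightarrow> f = 0"
  obtains \<B> F where "quotient_basis smul (fin_subspace \<rho>) \<B>"
    "\<B> \<subseteq> (\<lambda>x. x +o fin_subspace \<rho>) ` (\<Union>U\<in>\<U>. F U)" "\<forall>U\<in>\<U>. finite (F U)"
proof -
  let ?W = "fin_subspace \<rho>"
  have vs: "vector_space smul"
    using el by (simp add: elcs_def)
  interpret vector_space smul by fact
  interpret K: vector_space "(*) :: 'k \<Rightarrow> 'k \<Rightarrow> 'k"
    by unfold_locales (auto simp: algebra_simps)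
  interpret vector_space_pair smul "(*) :: 'k \<Rightarrow> 'k \<Rightarrow> 'k" ..
  obtain F where F: "\<And>U. U \<in> \<U> \<Longrightarrow> finite (F U)"
    "\<And>U f. U \<in> \<U> \<Longrightarrow> f \<in> dual_space smul \<tau> \<Longrightarrow> \<forall>x\<in>F U \<union> ?W. f x = 0 \<Longrightarrow> f \<in> U"
    using nbhd_in_dual_controls_finitely_many[OF el \<rho>] \<U> by metis
  let ?E = "\<Union>U\<in>\<U>. F U"
  have "span (?E \<union> ?W) = UNIV"
  proof (rule ccontr)
    assume "span (?E \<union> ?W) \<noteq> UNIV"
    then obtain x where "x \<notin> span (?E \<union> ?W)"
      by blast
    then obtain f where f: "Vector_Spaces.linear smul (*) f" "\<forall>s\<in>?E \<union> ?W. f s = 0" "f x = 1"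
      using exists_functional_separating_span by blast
    have scale_dual: "fun_scale a f \<in> dual_space smul \<tau>" for a
      using f linear_compose_scale_right[OF f(1), of a]
      by (intro functional_vanishing_on_fin_subspace_continuous[OF el \<rho>])
        (auto simp: fun_scale_def)
    have "fun_scale a f \<in> \<Inter>\<U>" for a
    proof (rule InterI)
      fix U assume U: "U \<in> \<U>"
      then have "\<forall>x\<in>F U \<union> ?W. fun_scale a f x = 0"
        using f(2) by (auto simp: fun_scale_def)
      with U scale_dual show "fun_scale a f \<in> U"
        by (rule F(2))
    qed
    moreover have "f \<in> dual_space smul \<tau>"
      using scale_dual[of 1] by (simp add: fun_scale_def)
    ultimately have "f = 0"
      using no_line by blast
    then show False
      using f(3) by simp
  qed
  moreover have "subspace ?W"
    using \<rho> vs by (simp add: continuous_extended_seminorm_def subspace_fin_subspace)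
  ultimately have "\<exists>D\<subseteq>?E. quotient_basis smul ?W ((\<lambda>d. d +o ?W) ` D)"
    by (intro quotient_basis_from_generators vs)
  then obtain D where "D \<subseteq> ?E" "quotient_basis smul ?W ((\<lambda>d. d +o ?W) ` D)"
    by (elim exE conjE)
  then show ?thesis
    using F(1) by (intro that[of "(\<lambda>d. d +o ?W) ` D" F] image_mono ballI)
qed


section \<open>Norm balls in the dual\<close>

lemma zero_in_dual_space:
  assumes "vector_space smul"
  shows "(0 :: 'x::ab_group_add \<Rightarrow> 'k::real_normed_field) \<in> dual_space smul \<tau>"
proof -
  interpret vector_space smul by fact
  interpret K: vector_space "(*) :: 'k \<Rightarrow> 'k \<Rightarrow> 'k"
    by unfold_locales (auto simp: algebra_simps)
  interpret vector_space_pair smul "(*) :: 'k \<Rightarrow> 'k \<Rightarrow> 'k" ..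
  show ?thesis
    using linear_zero by (simp add: dual_space_def zero_fun_def)
qed

lemma diff_in_dual_space:
  fixes f g :: "'x::ab_group_add \<Rightarrow> 'k::real_normed_field"
  assumes "f \<in> dual_space smul \<tau>" "g \<in> dual_space smul \<tau>"
  shows "f - g \<in> dual_space smul \<tau>"
proof -
  interpret f: Vector_Spaces.linear smul "(*)" f
    using assms(1) by (simp add: dual_space_def)
  interpret vector_space_pair smul "(*) :: 'k \<Rightarrow> 'k \<Rightarrow> 'k" ..
  show ?thesis
    using assms linear_compose_sub[of f g] continuous_map_diff[of \<tau> f g]
    by (simp add: dual_space_def fun_diff_def)
qed

text \<open>
  \<open>N\<close> is nonnegative and subadditive on \<open>S\<close> only.  Closure under differences keeps the
  displacement from the center of a ball inside \<open>S\<close>, where the triangle inequality is available.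
\<close>

lemma openin_norm_ball:
  assumes N: "is_norm_on sc S N" and diff: "\<And>f g. f \<in> S \<Longrightarrow> g \<in> S \<Longrightarrow> f - g \<in> S"
  shows "openin (seminorm_topology S {\<lambda>f. ennreal (N f)}) {f \<in> S. N f < r}"
  unfolding openin_seminorm_topology
proof (intro conjI ballI)
  fix g assume "g \<in> {f \<in> S. N f < r}"
  then have g: "g \<in> S" "0 < r - N g" by auto
  have "h \<in> {f \<in> S. N f < r}" if "h \<in> seminorm_nbhd S {\<lambda>f. ennreal (N f)} (r - N g) g" for h
  proof -
    have h: "h \<in> S" "ennreal (N (h - g)) < ennreal (r - N g)"
      using that by (auto simp: seminorm_nbhd_def)
    have hg: "h - g \<in> S" by (intro diff h g)
    then have "N (h - g) < r - N g"
      using h(2) N by (auto simp: is_norm_on_def ennreal_less_iff)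
    moreover have "N (g + (h - g)) \<le> N g + N (h - g)"
      using N g(1) hg unfolding is_norm_on_def by blast
    ultimately show ?thesis
      using h(1) by simp
  qed
  then show "\<exists>J \<epsilon>. finite J \<and> J \<subseteq> {\<lambda>f. ennreal (N f)} \<and> 0 < \<epsilon> \<and>
      seminorm_nbhd S J \<epsilon> g \<subseteq> {f \<in> S. N f < r}"
    using g(2) by (intro exI[of _ "{\<lambda>f. ennreal (N f)}"] exI[of _ "r - N g"]) auto
qed auto


section \<open>Normable and metrizable duals\<close>

theorem theorem5p4:
  fixes smul :: "'k::real_normed_field \<Rightarrow> 'x::ab_group_add \<Rightarrow> 'x"
    and \<tau> :: "'x topology"
  assumes "elcs smul \<tau>"
  shows "(normable (fun_scale :: 'k \<Rightarrow> ('x \<Rightarrow> 'k) \<Rightarrow> ('x \<Rightarrow> 'k)) (ucb_topology smul \<tau>) \<longrightarrow>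
            (\<forall>\<rho>. continuous_extended_seminorm smul \<tau> \<rho> \<longrightarrow>
                 finite_dim_quotient smul (fin_subspace \<rho>)))
       \<and> (metrizable_space (ucb_topology smul \<tau>) \<longrightarrow>
            (\<forall>\<rho>. continuous_extended_seminorm smul \<tau> \<rho> \<longrightarrow>
                 countable_dim_quotient smul (fin_subspace \<rho>)))"
proof (intro conjI impI allI)
  let ?S = "dual_space smul \<tau>" and ?T = "ucb_topology smul \<tau>"
  have top: "topspace ?T = ?S"
    by (simp add: ucb_topology_def)
  have zero_dual: "0 \<in> ?S"
    using assms by (simp add: elcs_def zero_in_dual_space)
  show "finite_dim_quotient smul (fin_subspace \<rho>)"
    if norm: "normable (fun_scale :: 'k \<Rightarrow> ('x \<Rightarrow> 'k) \<Rightarrow> ('x \<Rightarrow> 'k)) ?T"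
      and \<rho>: "continuous_extended_seminorm smul \<tau> \<rho>" for \<rho>
  proof -
    obtain N where N: "is_norm_on fun_scale ?S N"
      and T: "?T = seminorm_topology ?S {\<lambda>f. ennreal (N f)}"
      using norm unfolding normable_def top by blast
    let ?U = "{f \<in> ?S. N f < 1}"
    have "openin ?T ?U"
      unfolding T using N diff_in_dual_space by (rule openin_norm_ball)
    moreover have "0 \<in> ?U"
      using N zero_dual by (auto simp: is_norm_on_def)
    ultimately have U: "openin ?T V \<and> 0 \<in> V" if "V \<in> {?U}" for V
      using that by simp
    have no_line: "f = 0" if f: "f \<in> ?S" and line: "\<And>a::'k. fun_scale a f \<in> \<Inter>{?U}" for f
    proof (rule ccontr)
      \<comment> \<open>The multiple of \<open>f\<close> of norm \<open>1\<close> lies on the line but not in the open unit ball.\<close>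
      assume "f \<noteq> 0"
      then have "N f > 0"
        using N f by (auto simp: is_norm_on_def less_le)
      then have "N (fun_scale (of_real (inverse (N f))) f) = 1"
        using N f by (auto simp: is_norm_on_def norm_inverse)
      then show False
        using line[of "of_real (inverse (N f))"] by simp
    qed
    obtain \<B> F where "quotient_basis smul (fin_subspace \<rho>) \<B>"
      "\<B> \<subseteq> (\<lambda>x. x +o fin_subspace \<rho>) ` (\<Union>V\<in>{?U}. F V)" "\<forall>V\<in>{?U}. finite (F V)"
      by (rule quotient_basis_from_dual_nbhds[OF assms \<rho> U no_line])
    moreover from this have "finite (\<Union>V\<in>{?U}. F V)"
      by simp
    ultimately show ?thesis
      unfolding finite_dim_quotient_def by (meson finite_imageI finite_subset)
  qed
  show "countable_dim_quotient smul (fin_subspace \<rho>)"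
    if metr: "metrizable_space ?T" and \<rho>: "continuous_extended_seminorm smul \<tau> \<rho>" for \<rho>
  proof -
    obtain M d where "Metric_space M d" and T: "?T = Metric_space.mtopology M d"
      using metr unfolding metrizable_space_def by blast
    interpret Metric_space M d by fact
    have M: "M = ?S"
      using top T by simp
    have M0: "0 \<in> M"
      unfolding M by (rule zero_dual)
    let ?\<U> = "range (\<lambda>n. mball 0 (inverse (real (Suc n))))"
    have U: "openin ?T U \<and> 0 \<in> U" if "U \<in> ?\<U>" for U
      using that M0 T by auto
    have no_line: "f = 0" if f: "f \<in> ?S" and line: "\<And>a::'k. fun_scale a f \<in> \<Inter>?\<U>" for f
    proof (rule ccontr)
      assume "f \<noteq> 0"
      then have "0 < d 0 f"
        using mdist_pos_less[of 0 f] M0 f M by blast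
      then obtain n where "inverse (real (Suc n)) < d 0 f"
        using reals_Archimedean by blast
      moreover have "f \<in> mball 0 (inverse (real (Suc n)))"
        using line[of 1] by (simp add: fun_scale_def)
      ultimately show False
        by simp
    qed
    obtain \<B> F where "quotient_basis smul (fin_subspace \<rho>) \<B>"
      "\<B> \<subseteq> (\<lambda>x. x +o fin_subspace \<rho>) ` (\<Union>U\<in>?\<U>. F U)" "\<forall>U\<in>?\<U>. finite (F U)"
      by (rule quotient_basis_from_dual_nbhds[OF assms \<rho> U no_line])
    moreover from this have "countable (\<Union>U\<in>?\<U>. F U)"
      by (intro countable_UN) (auto intro: countable_finite)
    ultimately show ?thesis
      unfolding countable_dim_quotient_def by (meson countable_image countable_subset)
  qed
qed

end
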